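(* Let $P$ be an ergodic transition matrix over a finite space $\mathcal{X}$, $\mu$ a probability distribution on $\mathcal{X}$, $\delta\in(0,1)$, $\lambda\in(0,\infty)^{\mathcal{X}}$ a smoothing vector, $m\in\mathbb{N}$, and $X^m=X_1,\dots,X_m\sim(\mu,P)$. With probability at least $1-\delta$, it holds that $$\left\|\widehat{P}_\lambda(X^m)-P\right\|_\infty\le\widehat{W}_{\lambda,\delta}(X^m),$$ with $$\widehat{W}_{\lambda,\delta}(X^m)=2\max_{x\in\mathcal{X}}\left\{\frac{\sum_{x'\in\mathcal{X}}\sqrt{N_{xx'}}+(3/\sqrt2)\sqrt{N_x}\sqrt{\log(2m|\mathcal{X}|/\delta)}+\lambda(x)|\mathcal{X}|}{N_x+\lambda(x)|\mathcal{X}|}\right\}.$$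
   Context: $\mathbb{N}=\{1,2,\dots\}$ and $\log$ is the natural logarithm. A row-stochastic matrix $P$ over a finite set is ergodic if it is primitive ($P^q>0$ entrywise for some $q\in\mathbb{N}$). $X^m\sim(\mu,P)$ means that $X_1,\dots,X_m$ is a trajectory of the time-homogeneous Markov chain with initial distribution $\mu$ and transition matrix $P$. Counting variables: $N_x=\sum_{t=1}^{m-1}\mathbf{1}\{X_t=x\}$ and $N_{xx'}=\sum_{t=1}^{m-1}\mathbf{1}\{X_t=x,X_{t+1}=x'\}$. The smoothed estimator is the matrix with entries $\widehat{P}_\lambda(x,x')=\frac{N_{xx'}+\lambda(x)}{N_x+\lambda(x)|\mathcal{X}|}$. For a matrix $A$ over $\mathcal{X}$, $\|A\|_\infty=\max_{x}\sum_{x'}|A(x,x')|$. *)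

theory Defs
  imports "HOL-Probability.Probability"
begin

text \<open>
  The state space is a finite type \<open>'x\<close> (nonempty, as every type is); a matrix over it is
  an element of \<open>real ^ 'x ^ 'x\<close>, with \<open>P $ x $ x'\<close> the probability of moving from \<open>x\<close> to \<open>x'\<close>.
\<close>

definition row_stochastic :: "real ^ 'x ^ 'x \<Rightarrow> bool" where
  "row_stochastic P \<longleftrightarrow> (\<forall>x x'. 0 \<le> P $ x $ x') \<and> (\<forall>x. (\<Sum>x'\<in>UNIV. P $ x $ x') = 1)"

text \<open>The overloaded power on vectors of vectors is entrywise, hence iteration of \<open>(**)\<close>.\<close>

definition mat_power :: "real ^ 'x ^ 'x \<Rightarrow> nat \<Rightarrow> real ^ 'x ^ 'x" where
  "mat_power P q = (((**) P) ^^ q) (mat 1)"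

definition ergodic :: "real ^ 'x ^ 'x \<Rightarrow> bool" where
  "ergodic P \<longleftrightarrow> row_stochastic P \<and> (\<exists>q\<ge>1. \<forall>x x'. 0 < mat_power P q $ x $ x')"

text \<open>
  \<open>X 1, \<dots>, X m\<close> are random variables on \<open>M\<close> whose joint law is that of the time-homogeneous
  Markov chain with initial distribution \<open>\<mu>\<close> and transition matrix \<open>P\<close>:
  a path \<open>x\<^sub>1, \<dots>, x\<^sub>m\<close> has probability \<open>\<mu>(x\<^sub>1) P(x\<^sub>1, x\<^sub>2) \<cdots> P(x\<^sub>m\<^sub>-\<^sub>1, x\<^sub>m)\<close>.
  Paths are indexed from 1; values at other indices are irrelevant throughout.
\<close>

definition markov_trajectory ::
    "'w measure \<Rightarrow> (nat \<Rightarrow> 'w \<Rightarrow> 'x::finite) \<Rightarrow> nat \<Rightarrow> 'x pmf \<Rightarrow> real ^ 'x ^ 'x \<Rightarrow> bool" where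
  "markov_trajectory M X m \<mu> P \<longleftrightarrow>
     prob_space M \<and>
     (\<forall>t\<in>{1..m}. X t \<in> measurable M (count_space UNIV)) \<and>
     (\<forall>xs :: nat \<Rightarrow> 'x.
        measure M {\<omega> \<in> space M. \<forall>t\<in>{1..m}. X t \<omega> = xs t}
          = pmf \<mu> (xs 1) * (\<Prod>t\<in>{1..<m}. P $ xs t $ xs (t + 1)))"

definition visits :: "nat \<Rightarrow> (nat \<Rightarrow> 'x) \<Rightarrow> 'x \<Rightarrow> real" where
  "visits m xs x = (\<Sum>t\<in>{1..<m}. of_bool (xs t = x))"

definition transitions :: "nat \<Rightarrow> (nat \<Rightarrow> 'x) \<Rightarrow> 'x \<Rightarrow> 'x \<Rightarrow> real" where
  "transitions m xs x x' = (\<Sum>t\<in>{1..<m}. of_bool (xs t = x \<and> xs (t + 1) = x'))"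

text \<open>\<open>lam\<close> is the smoothing vector \<open>\<lambda>\<close>, whose name is reserved for abstraction.\<close>

definition smoothed_estimator ::
    "('x \<Rightarrow> real) \<Rightarrow> nat \<Rightarrow> (nat \<Rightarrow> 'x) \<Rightarrow> real ^ 'x ^ 'x" where
  "smoothed_estimator lam m xs =
     (\<chi> x x'. (transitions m xs x x' + lam x) / (visits m xs x + lam x * real CARD('x)))"

definition norm_inf :: "real ^ 'x ^ 'x \<Rightarrow> real" where
  "norm_inf A = Max (range (\<lambda>x. \<Sum>x'\<in>UNIV. \<bar>A $ x $ x'\<bar>))"

definition W_hat :: "('x \<Rightarrow> real) \<Rightarrow> real \<Rightarrow> nat \<Rightarrow> (nat \<Rightarrow> 'x::finite) \<Rightarrow> real" where
  "W_hat lam \<delta> m xs =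
     2 * Max (range (\<lambda>x.
       ((\<Sum>x'\<in>UNIV. sqrt (transitions m xs x x'))
         + (3 / sqrt 2) * sqrt (visits m xs x) * sqrt (ln (2 * real m * real CARD('x) / \<delta>))
         + lam x * real CARD('x))
       / (visits m xs x + lam x * real CARD('x))))"

end

theory Submission
  imports Defs
begin

text \<open>
  The transitions out of a fixed state \<open>x\<close> behave like i.i.d.\ draws from the row \<open>p = P(x, \<cdot>)\<close>. For \<open>n\<close> such
  draws with counts \<open>c\<close>, put \<open>F(c) = \<Sum>\<^sub>z |c\<^sub>z - n p\<^sub>z| - 2 \<Sum>\<^sub>z \<surd>c\<^sub>z\<close>. Replacing one draw changes \<open>F\<close> by at most
  \<open>4\<close>, and \<open>E F \<le> 0\<close>, so McDiarmid's inequality gives \<open>Pr(F > t) \<le> exp(-t\<^sup>2 / (8 n))\<close>. With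
  \<open>t = 3 \<surd>2 \<surd>(n L)\<close> and \<open>L = log(2 m |X| / \<delta>)\<close> this is \<open>exp(-9 L / 4) \<le> exp(-L)\<close>, which leaves room for a union
  bound over \<open>x\<close> and the possible values \<open>n\<close> of \<open>N\<^sub>x\<close>. The randomness of \<open>N\<^sub>x\<close> is handled without
  constructing the i.i.d.\ sequence: the conditional probability of the bad event given the current
  counts is a supermartingale along the chain.
\<close>

section \<open>Counts of independent draws from a fixed distribution\<close>

definition inc :: "('x \<Rightarrow> nat) \<Rightarrow> 'x \<Rightarrow> 'x \<Rightarrow> nat" where
  "inc c z = c(z := Suc (c z))"

lemma inc_commute: "inc (inc c z) w = inc (inc c w) z"
  by (auto simp: inc_def fun_eq_iff)

lemma sum_inc:
  fixes g :: "'x::finite \<Rightarrow> nat \<Rightarrow> 'b::ab_group_add"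
  shows "(\<Sum>w\<in>UNIV. g w (inc c z w)) = (\<Sum>w\<in>UNIV. g w (c w)) + (g z (Suc (c z)) - g z (c z))"
proof -
  have "(\<Sum>w\<in>UNIV - {z}. g w (inc c z w)) = (\<Sum>w\<in>UNIV - {z}. g w (c w))"
    by (intro sum.cong) (auto simp: inc_def)
  then show ?thesis
    by (simp add: sum.remove[of UNIV z] inc_def)
qed

lemma sum_inc_nat:
  fixes c :: "'x::finite \<Rightarrow> nat"
  shows "sum (inc c z) UNIV = Suc (sum c UNIV)"
proof -
  have "(\<Sum>w\<in>UNIV - {z}. inc c z w) = (\<Sum>w\<in>UNIV - {z}. c w)"
    by (intro sum.cong) (auto simp: inc_def)
  then show ?thesis
    by (simp add: sum.remove[of UNIV z] inc_def)
qed

locale finite_distribution =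
  fixes p :: "'x::finite \<Rightarrow> real"
  assumes nonneg: "0 \<le> p z" and sum_one: "(\<Sum>z\<in>UNIV. p z) = 1"
begin

text \<open>Expectation of \<open>f\<close> after one more sample from \<open>p\<close> has been added to the counts \<open>c\<close>;
  its \<open>n\<close>-th power at \<open>c = 0\<close> is the expectation under the multinomial distribution.\<close>

definition draw :: "(('x \<Rightarrow> nat) \<Rightarrow> real) \<Rightarrow> ('x \<Rightarrow> nat) \<Rightarrow> real" where
  "draw f c = (\<Sum>z\<in>UNIV. p z * f (inc c z))"

lemma draw_pow_Suc: "(draw ^^ Suc n) f c = (\<Sum>z\<in>UNIV. p z * (draw ^^ n) f (inc c z))"
  by (simp add: draw_def)

lemma draw_mono: "(\<And>c. f c \<le> g c) \<Longrightarrow> draw f c \<le> draw g c"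
  unfolding draw_def by (intro sum_mono mult_left_mono nonneg)

lemma draw_pow_mono: "(\<And>c. f c \<le> g c) \<Longrightarrow> (draw ^^ n) f c \<le> (draw ^^ n) g c"
  by (induction n arbitrary: c) (auto intro: draw_mono)

lemma draw_pow_sum: "(draw ^^ n) (\<lambda>c. \<Sum>w\<in>W. g w c) c = (\<Sum>w\<in>W. (draw ^^ n) (g w) c)"
proof (induction n arbitrary: c)
  case (Suc n)
  have "(draw ^^ Suc n) (\<lambda>c. \<Sum>w\<in>W. g w c) c
      = (\<Sum>z\<in>UNIV. \<Sum>w\<in>W. p z * (draw ^^ n) (g w) (inc c z))"
    by (simp only: draw_pow_Suc Suc sum_distrib_left)
  also have "\<dots> = (\<Sum>w\<in>W. (draw ^^ Suc n) (g w) c)"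
    by (subst sum.swap) (simp only: draw_pow_Suc)
  finally show ?case .
qed simp

lemma draw_pow_scale: "(draw ^^ n) (\<lambda>c. k * f c) c = k * (draw ^^ n) f c"
  by (induction n arbitrary: c) (auto simp: draw_pow_Suc sum_distrib_left mult_ac simp del: funpow.simps(2))

lemma draw_pow_const: "(draw ^^ n) (\<lambda>_. k) c = k"
  by (induction n arbitrary: c)
    (auto simp: draw_pow_Suc sum_one simp del: funpow.simps(2) simp flip: sum_distrib_right)

subsection \<open>McDiarmid's inequality for counts\<close>

text \<open>Hoeffding's lemma on the point measure of \<open>p\<close>, with the centring moved to
  the right-hand side. Only the oscillation of \<open>v\<close> is bounded, so the interval is taken
  to start at the minimum of \<open>v\<close>.\<close>

lemma hoeffding_finite:
  assumes v: "\<And>z z'. v z - v z' \<le> d" and s: "0 < s"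
  shows "(\<Sum>z\<in>UNIV. p z * exp (s * v z)) \<le> exp (s * (\<Sum>z\<in>UNIV. p z * v z) + s\<^sup>2 * d\<^sup>2 / 8)"
proof -
  let ?M = "point_measure UNIV p"
  let ?e = "\<Sum>z\<in>UNIV. p z * v z"
  define a where "a = Min (range v)"
  have a: "a \<le> v z" "v z \<le> a + d" for z
  proof -
    show "a \<le> v z"
      by (simp add: a_def)
    have "a \<in> range v"
      unfolding a_def by (intro Min_in) auto
    then show "v z \<le> a + d"
      using v[of z] by (auto simp: algebra_simps)
  qed
  interpret prob_space ?M
    by standard (simp add: emeasure_point_measure_finite space_point_measure nonneg sum_one)
  interpret interval_bounded_random_variable ?M v a "a + d"
    by standard (use a in \<open>auto simp: measurable_def space_point_measure sets_point_measure\<close>)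
  have e: "expectation v = ?e"
    by (simp add: lebesgue_integral_point_measure_finite nonneg)
  have "(\<integral>\<^sup>+z. ennreal (exp (s * (v z - ?e))) \<partial>?M) \<le> ennreal (exp (s\<^sup>2 * d\<^sup>2 / 8))"
    using Hoeffdings_lemma_nn_integral[OF s] unfolding e by simp
  moreover have "(\<integral>\<^sup>+z. ennreal (exp (s * (v z - ?e))) \<partial>?M)
      = ennreal (\<Sum>z\<in>UNIV. p z * exp (s * (v z - ?e)))"
    by (simp add: nn_integral_point_measure_finite nonneg sum_nonneg flip: ennreal_mult)
  ultimately have "(\<Sum>z\<in>UNIV. p z * exp (s * (v z - ?e))) \<le> exp (s\<^sup>2 * d\<^sup>2 / 8)"
    by (simp add: ennreal_le_iff)
  then have "exp (s * ?e) * (\<Sum>z\<in>UNIV. p z * exp (s * (v z - ?e))) \<le> exp (s * ?e) * exp (s\<^sup>2 * d\<^sup>2 / 8)"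
    by (intro mult_left_mono) auto
  moreover have "exp (s * ?e) * (\<Sum>z\<in>UNIV. p z * exp (s * (v z - ?e))) = (\<Sum>z\<in>UNIV. p z * exp (s * v z))"
    by (subst sum_distrib_left) (simp add: right_diff_distrib exp_diff)
  ultimately show ?thesis
    by (simp add: exp_add)
qed

text \<open>The last draw is averaged out first: Hoeffding's lemma costs one factor
  \<open>?K\<close> and leaves \<open>draw f\<close>. Since increments commute,
  \<open>draw f\<close> again has differences at most \<open>d\<close>, and the induction goes on
  with it in place of \<open>f\<close>.\<close>

lemma mcdiarmid:
  assumes "\<And>c z z'. f (inc c z) - f (inc c z') \<le> d" and s: "0 < s"
  shows "(draw ^^ n) (\<lambda>c. exp (s * f c)) c \<le> exp (s * (draw ^^ n) f c + real n * (s\<^sup>2 * d\<^sup>2 / 8))"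
  using assms(1)
proof (induction n arbitrary: f c)
  case (Suc n)
  let ?K = "exp (s\<^sup>2 * d\<^sup>2 / 8)"
  have bd: "draw f (inc c z) - draw f (inc c z') \<le> d" for c z z'
  proof -
    have "draw f (inc c z) - draw f (inc c z') = (\<Sum>w\<in>UNIV. p w * (f (inc (inc c w) z) - f (inc (inc c w) z')))"
      by (simp add: draw_def inc_commute[of c] sum_subtractf right_diff_distrib)
    also have "\<dots> \<le> (\<Sum>w\<in>UNIV. p w * d)"
      by (intro sum_mono mult_left_mono Suc.prems nonneg)
    finally show ?thesis
      by (simp add: sum_one flip: sum_distrib_right)
  qed
  have "(draw ^^ Suc n) (\<lambda>c. exp (s * f c)) c = (draw ^^ n) (draw (\<lambda>c. exp (s * f c))) c"
    by (simp only: funpow_Suc_right o_apply)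
  also have "\<dots> \<le> (draw ^^ n) (\<lambda>c. ?K * exp (s * draw f c)) c"
  proof (rule draw_pow_mono)
    fix c
    show "draw (\<lambda>c. exp (s * f c)) c \<le> ?K * exp (s * draw f c)"
      using hoeffding_finite[of "\<lambda>z. f (inc c z)" d s] Suc.prems s
      by (simp add: draw_def exp_add mult.commute)
  qed
  also have "\<dots> = ?K * (draw ^^ n) (\<lambda>c. exp (s * draw f c)) c"
    by (rule draw_pow_scale)
  also have "\<dots> \<le> ?K * exp (s * (draw ^^ n) (draw f) c + real n * (s\<^sup>2 * d\<^sup>2 / 8))"
    by (intro mult_left_mono Suc.IH bd) auto
  also have "\<dots> = exp (s * (draw ^^ Suc n) f c + real (Suc n) * (s\<^sup>2 * d\<^sup>2 / 8))"
    by (simp add: funpow_Suc_right algebra_simps add_divide_distrib del: funpow.simps flip: exp_add)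
  finally show ?case .
qed simp

subsection \<open>The deviation of counts and their square roots\<close>

text \<open>Each coordinate grows by a binomial variable of mean \<open>n * p z\<close> and variance
  \<open>n * p z * (1 - p z)\<close>.\<close>

lemma draw_pow_quadratic:
  fixes \<alpha> \<beta> \<gamma> :: real
  shows "(draw ^^ n) (\<lambda>c. \<alpha> + \<beta> * c z + \<gamma> * (real (c z))\<^sup>2) c
     = \<alpha> + \<beta> * (c z + n * p z)
       + \<gamma> * ((c z + n * p z)\<^sup>2 + n * p z * (1 - p z))"
proof (induction n arbitrary: c)
  case (Suc n)
  let ?k = "real (c z)"
  let ?Q = "\<lambda>k. \<alpha> + \<beta> * (k + n * p z) + \<gamma> * ((k + n * p z)\<^sup>2 + n * p z * (1 - p z))"
  have "(draw ^^ Suc n) (\<lambda>c. \<alpha> + \<beta> * c z + \<gamma> * (real (c z))\<^sup>2) c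
      = (\<Sum>w\<in>UNIV. p w * ?Q (real (inc c w z)))"
    by (simp only: draw_pow_Suc Suc)
  also have "\<dots> = (\<Sum>w\<in>UNIV. p w * ?Q ?k + (if w = z then p w * (?Q (?k + 1) - ?Q ?k) else 0))"
    by (intro sum.cong refl) (auto simp: inc_def algebra_simps)
  also have "\<dots> = ?Q ?k + p z * (?Q (?k + 1) - ?Q ?k)"
    by (simp add: sum.distrib sum_one flip: sum_distrib_right)
  also have "\<dots> = \<alpha> + \<beta> * (?k + Suc n * p z)
       + \<gamma> * ((?k + Suc n * p z)\<^sup>2 + Suc n * p z * (1 - p z))"
    by (simp add: algebra_simps power2_eq_square)
  finally show ?case .
qed simp

text \<open>The variance is relaxed to \<open>n * p z\<close>, so that the condition to check
  involves the mean \<open>n * p z\<close> alone.\<close>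

lemma draw_pow_coordinate_nonpos:
  fixes \<alpha> \<beta> \<gamma> :: real and g :: "nat \<Rightarrow> real"
  assumes "\<And>k. g k \<le> \<alpha> + \<beta> * k + \<gamma> * (real k)\<^sup>2" and "0 \<le> \<gamma>"
    and "\<alpha> + \<beta> * (n * p z) + \<gamma> * ((n * p z)\<^sup>2 + n * p z) \<le> 0"
  shows "(draw ^^ n) (\<lambda>c. g (c z)) (\<lambda>_. 0) \<le> 0"
proof -
  have "(draw ^^ n) (\<lambda>c. g (c z)) (\<lambda>_. 0) \<le> (draw ^^ n) (\<lambda>c. \<alpha> + \<beta> * c z + \<gamma> * (real (c z))\<^sup>2) (\<lambda>_. 0)"
    by (intro draw_pow_mono assms(1))
  also have "\<dots> = \<alpha> + \<beta> * (n * p z) + \<gamma> * ((n * p z)\<^sup>2 + n * p z * (1 - p z))"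
    by (subst draw_pow_quadratic) simp
  also have "\<dots> \<le> \<alpha> + \<beta> * (n * p z) + \<gamma> * ((n * p z)\<^sup>2 + n * p z)"
    using nonneg[of z] assms(2) by (intro add_left_mono mult_left_mono) (auto intro!: mult_left_le)
  finally show ?thesis
    using assms(3) by linarith
qed

end

text \<open>The parabola meets \<open>2 * sqrt u\<close> at 0 and is tangent to it at 1, which
  explains the factors \<open>v\<close> and \<open>(v - 1)\<^sup>2\<close> of the
  difference.\<close>

lemma sqrt_ge_quadratic:
  fixes u :: real
  assumes "0 \<le> u"
  shows "3 * u - u\<^sup>2 \<le> 2 * sqrt u"
proof -
  define v where "v = sqrt u"
  have v: "0 \<le> v" "u = v\<^sup>2"
    using assms by (auto simp: v_def)
  have "2 * v - (3 * u - u\<^sup>2) = v * (v + 2) * (v - 1)\<^sup>2"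
    unfolding v by (simp add: algebra_simps power2_eq_square power_numeral_reduce)
  moreover have "\<dots> \<ge> 0"
    using v by auto
  ultimately show ?thesis
    by (simp add: v_def)
qed

context finite_distribution
begin

text \<open>The pointwise bound is a quadratic polynomial in the count, so only the first two moments
  of the binomial distribution enter. For \<open>n p < 1\<close> a second-order expansion at scale \<open>n p\<close> is too weak;
  there \<open>|k - n p| = k - n p + 2 n p 1{k = 0}\<close> and \<open>2 1{k = 0} \<le> (1 - k) (2 - k)\<close> are used,
  the latter being valid for integers only.\<close>

lemma draw_pow_deviation_le_sqrt:
  "(draw ^^ n) (\<lambda>c. \<bar>real (c z) - n * p z\<bar> - 2 * sqrt (c z)) (\<lambda>_. 0) \<le> 0"
proof (cases "n * p z \<le> 1")
  case True
  define a where "a = n * p z"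
  have a: "0 \<le> a" "a \<le> 1"
    using True nonneg[of z] by (auto simp: a_def)
  have "(draw ^^ n) (\<lambda>c. (\<lambda>k. \<bar>real k - a\<bar> - 2 * sqrt k) (c z)) (\<lambda>_. 0) \<le> 0"
  \<comment> \<open>The coefficients of \<open>k - a + a * ((1 - k) * (2 - k))\<close> minus
    \<open>3 * k - k\<^sup>2\<close>. With mean \<open>a\<close> and variance bound \<open>a\<close>
    they evaluate to \<open>- a * a * (1 - a)\<close>.\<close>
  proof (rule draw_pow_coordinate_nonpos[where \<alpha> = a and \<beta> = "- 2 - 3 * a" and \<gamma> = "1 + a"])
    fix k :: nat
    have "\<bar>real k - a\<bar> \<le> real k - a + a * ((1 - real k) * (2 - real k))"
    proof (cases "k = 0")
      case False
      have "0 \<le> (1 - real k) * (2 - real k)"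
        using False by (cases "k = 1") (auto intro!: mult_nonpos_nonpos)
      then have "0 \<le> a * ((1 - real k) * (2 - real k))"
        using a by simp
      then show ?thesis
        using False a by simp
    qed (use a in simp)
    then show "\<bar>real k - a\<bar> - 2 * sqrt k \<le> a + (- 2 - 3 * a) * k + (1 + a) * (real k)\<^sup>2"
      using sqrt_ge_quadratic[of "real k"] by (simp add: algebra_simps power2_eq_square)
  next
    have "0 \<le> a * a * (1 - a)"
      using a by simp
    then show "a + (- 2 - 3 * a) * (n * p z) + (1 + a) * ((n * p z)\<^sup>2 + n * p z) \<le> 0"
      by (simp add: algebra_simps power2_eq_square flip: a_def)
  qed (use a in auto)
  then show ?thesis
    by (simp add: a_def)
next
  case False
  define r where "r = sqrt (n * p z)"
  have r: "1 < r" "n * p z = r\<^sup>2"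
    using False by (auto simp: r_def)
  have "(draw ^^ n) (\<lambda>c. (\<lambda>k. \<bar>real k - r\<^sup>2\<bar> - 2 * sqrt k) (c z)) (\<lambda>_. 0) \<le> 0"
  \<comment> \<open>The coefficients come from expanding an AM-GM bound on the absolute value, at
    the scale \<open>r\<close> that bounds the standard deviation, minus the parabola below the
    square root. In the moments they leave \<open>1 / r - r\<close>.\<close>
  proof (rule draw_pow_coordinate_nonpos[where \<alpha> = "r ^ 3 / 2 + r / 2" and \<beta> = "- r - 3 / r"
        and \<gamma> = "1 / (2 * r) + 1 / r ^ 3"])
    fix k :: nat
    have "0 \<le> (\<bar>real k - r\<^sup>2\<bar> - r)\<^sup>2"
      by simp
    then have "\<bar>real k - r\<^sup>2\<bar> * (2 * r) \<le> (real k - r\<^sup>2)\<^sup>2 + r\<^sup>2"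
      by (simp add: power2_diff)
    then have 1: "\<bar>real k - r\<^sup>2\<bar> \<le> ((real k - r\<^sup>2)\<^sup>2 + r\<^sup>2) / (2 * r)"
      using r by (simp add: pos_le_divide_eq)
    \<comment> \<open>Rescaling by \<open>r\<^sup>2\<close> moves the point of tangency to the
      mean.\<close>
    have "r * (3 * (k / r\<^sup>2) - (k / r\<^sup>2)\<^sup>2) \<le> r * (2 * sqrt (k / r\<^sup>2))"
      using r by (intro mult_left_mono sqrt_ge_quadratic) auto
    also have "\<dots> = 2 * sqrt k"
      using r by (simp add: real_sqrt_divide)
    finally have 2: "r * (3 * (k / r\<^sup>2) - (k / r\<^sup>2)\<^sup>2) \<le> 2 * sqrt k" .
    have "((real k - r\<^sup>2)\<^sup>2 + r\<^sup>2) / (2 * r) - r * (3 * (k / r\<^sup>2) - (k / r\<^sup>2)\<^sup>2)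
        = r ^ 3 / 2 + r / 2 + (- r - 3 / r) * k + (1 / (2 * r) + 1 / r ^ 3) * (real k)\<^sup>2"
      using r by (simp add: divide_simps) (simp add: algebra_simps eval_nat_numeral)
    then show "\<bar>real k - r\<^sup>2\<bar> - 2 * sqrt k
        \<le> r ^ 3 / 2 + r / 2 + (- r - 3 / r) * k + (1 / (2 * r) + 1 / r ^ 3) * (real k)\<^sup>2"
      using 1 2 by linarith
  next
    have "r ^ 3 / 2 + r / 2 + (- r - 3 / r) * r\<^sup>2 + (1 / (2 * r) + 1 / r ^ 3) * ((r\<^sup>2)\<^sup>2 + r\<^sup>2) = 1 / r - r"
      using r by (simp add: divide_simps) (simp add: algebra_simps eval_nat_numeral)
    moreover have "1 / r \<le> 1"
      using r by simp
    ultimately show "r ^ 3 / 2 + r / 2 + (- r - 3 / r) * (n * p z)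
        + (1 / (2 * r) + 1 / r ^ 3) * ((n * p z)\<^sup>2 + n * p z) \<le> 0"
      using r(1) unfolding r(2) by linarith
  qed (use r in auto)
  then show ?thesis
    by (simp add: r)
qed

text \<open>The centring uses the planned number \<open>n\<close> of draws rather than the sum of
  \<open>c\<close>, so the function stays fixed while the draws accumulate.\<close>

definition excess :: "nat \<Rightarrow> ('x \<Rightarrow> nat) \<Rightarrow> real" where
  "excess n c = (\<Sum>z\<in>UNIV. \<bar>real (c z) - n * p z\<bar> - 2 * sqrt (c z))"

text \<open>An increment moves the absolute value by at most 1 either way and lowers
  \<open>- 2 * sqrt k\<close> by at most 2. Each change thus lies between -3 and 1, and two of them
  differ by at most 4.\<close>

lemma excess_inc_diff: "excess n (inc c z) - excess n (inc c z') \<le> 4"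
proof -
  let ?g = "\<lambda>z k. \<bar>real k - n * p z\<bar> - 2 * sqrt k"
  have "?g z (Suc k) - ?g z k \<in> {-3..1}" for z :: 'x and k
  proof -
    have "sqrt (real k + 1) \<le> sqrt k + sqrt 1"
      by (rule sqrt_add_le_add_sqrt) auto
    moreover have "sqrt k \<le> sqrt (real k + 1)"
      by simp
    ultimately show ?thesis
      unfolding atLeastAtMost_iff of_nat_Suc real_sqrt_one by (simp only: add.commute) linarith
  qed
  from this[of "c z" z] this[of "c z'" z'] show ?thesis
    unfolding excess_def sum_inc[where g = ?g] by simp
qed

lemma excess_tail:
  assumes "0 < n" "0 < t"
  shows "(draw ^^ n) (\<lambda>c. of_bool (t < excess n c)) (\<lambda>_. 0) \<le> exp (- (t\<^sup>2 / (8 * n)))"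
proof -
  \<comment> \<open>The minimiser of the Chernoff exponent
    \<open>- s * t + 2 * n * s\<^sup>2\<close>.\<close>
  define s where "s = t / (4 * n)"
  have s: "0 < s"
    using assms by (simp add: s_def)
  have "(draw ^^ n) (\<lambda>c. of_bool (t < excess n c)) (\<lambda>_. 0)
      \<le> (draw ^^ n) (\<lambda>c. exp (- s * t) * exp (s * excess n c)) (\<lambda>_. 0)"
    using s by (intro draw_pow_mono) (auto simp flip: exp_add)
  also have "\<dots> = exp (- s * t) * (draw ^^ n) (\<lambda>c. exp (s * excess n c)) (\<lambda>_. 0)"
    by (rule draw_pow_scale)
  also have "\<dots> \<le> exp (- s * t) * exp (s * (draw ^^ n) (excess n) (\<lambda>_. 0) + n * (s\<^sup>2 * 4\<^sup>2 / 8))"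
    by (intro mult_left_mono mcdiarmid excess_inc_diff s) auto
  also have "\<dots> \<le> exp (- s * t) * exp (s * 0 + n * (s\<^sup>2 * 4\<^sup>2 / 8))"
  proof -
    have "(draw ^^ n) (excess n) (\<lambda>_. 0) \<le> 0"
      unfolding excess_def[abs_def] draw_pow_sum
      by (intro sum_nonpos draw_pow_deviation_le_sqrt)
    then have "s * (draw ^^ n) (excess n) (\<lambda>_. 0) \<le> s * 0"
      using s by (intro mult_left_mono) auto
    then show ?thesis
      by simp
  qed
  also have "\<dots> = exp (- (t\<^sup>2 / (8 * n)))"
    using assms by (simp add: s_def field_simps power2_eq_square flip: exp_add)
  finally show ?thesis .
qed

text \<open>Once more than \<open>n\<close> samples have been drawn the value drops to \<open>0\<close>,
  which keeps the process a supermartingale.\<close>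

definition conditional_tail :: "nat \<Rightarrow> (('x \<Rightarrow> nat) \<Rightarrow> real) \<Rightarrow> ('x \<Rightarrow> nat) \<Rightarrow> real" where
  "conditional_tail n f c = (if sum c UNIV \<le> n then (draw ^^ (n - sum c UNIV)) f c else 0)"

lemma conditional_tail_nonneg:
  assumes "\<And>c. 0 \<le> f c"
  shows "0 \<le> conditional_tail n f c"
  using draw_pow_mono[of "\<lambda>_. 0" f "n - sum c UNIV" c] assms
  by (simp add: conditional_tail_def draw_pow_const)

text \<open>Equality holds while fewer than \<open>n\<close> samples are present; afterwards the
  left-hand side vanishes.\<close>

lemma conditional_tail_supermartingale:
  assumes "\<And>c. 0 \<le> f c"
  shows "(\<Sum>z\<in>UNIV. p z * conditional_tail n f (inc c z)) \<le> conditional_tail n f c"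
proof (cases "sum c UNIV < n")
  case True
  then have "n - sum c UNIV = Suc (n - Suc (sum c UNIV))"
    by simp
  then show ?thesis
    using True by (simp add: conditional_tail_def sum_inc_nat draw_def)
next
  case False
  then have "(\<Sum>z\<in>UNIV. p z * conditional_tail n f (inc c z)) = 0"
    by (simp add: conditional_tail_def sum_inc_nat)
  then show ?thesis
    using conditional_tail_nonneg[OF assms] by simp
qed

end

subsection \<open>Transition counts along the chain\<close>

text \<open>Natural-number counts, so that a row of them can be fed to \<open>inc\<close> and
  \<open>draw\<close>.\<close>

definition transition_count :: "nat \<Rightarrow> (nat \<Rightarrow> 'x) \<Rightarrow> 'x \<Rightarrow> 'x \<Rightarrow> nat" where
  "transition_count m xs x x' = (\<Sum>t\<in>{1..<m}. of_bool (xs t = x \<and> xs (t + 1) = x'))"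

lemma transitions_eq_count: "transitions m xs x x' = real (transition_count m xs x x')"
  by (simp add: transitions_def transition_count_def)

lemma visits_eq_count: "visits m xs x = real (sum (transition_count m xs x) (UNIV :: 'x::finite set))"
proof -
  have "sum (transition_count m xs x) UNIV = (\<Sum>t\<in>{1..<m}. \<Sum>x'\<in>UNIV. of_bool (xs t = x \<and> xs (t + 1) = x'))"
    unfolding transition_count_def by (rule sum.swap)
  also have "\<dots> = (\<Sum>t\<in>{1..<m}. of_bool (xs t = x))"
    by (intro sum.cong refl) (simp add: of_bool_conj flip: sum_distrib_left)
  finally show ?thesis
    by (simp add: visits_def)
qed

lemma sum_transition_count_less:
  assumes "1 \<le> m"
  shows "sum (transition_count m xs x) (UNIV :: 'x::finite set) < m"
proof -
  have "visits m xs x \<le> (\<Sum>t\<in>{1..<m}. 1)"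
    unfolding visits_def by (intro sum_mono) auto
  then show ?thesis
    using assms by (simp add: visits_eq_count del: of_nat_sum)
qed

lemma transition_count_cong:
  assumes "\<And>t. t \<in> {1..m} \<Longrightarrow> xs t = ys t"
  shows "transition_count m xs = transition_count m ys"
  by (auto simp: transition_count_def fun_eq_iff assms intro!: sum.cong)

lemma transition_count_Suc:
  assumes "1 \<le> k"
  shows "transition_count (Suc k) (xs(Suc k := z)) x
    = (if xs k = x then inc (transition_count k xs x) z else transition_count k xs x)"
proof -
  have "transition_count k (xs(Suc k := z)) = transition_count k xs"
    by (rule transition_count_cong) auto
  then have "transition_count k (xs(Suc k := z)) x w = transition_count k xs x w" for w
    by simp
  then show ?thesis
    using assms by (auto simp: transition_count_def inc_def fun_eq_iff)
qed

definition path_prob :: "nat \<Rightarrow> 'x pmf \<Rightarrow> real ^ 'x::finite ^ 'x \<Rightarrow> (nat \<Rightarrow> 'x) \<Rightarrow> real" where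
  "path_prob m \<mu> P xs = pmf \<mu> (xs 1) * (\<Prod>t\<in>{1..<m}. P $ xs t $ xs (t + 1))"

lemma path_prob_nonneg: "row_stochastic P \<Longrightarrow> 0 \<le> path_prob m \<mu> P xs"
  by (simp add: path_prob_def row_stochastic_def prod_nonneg)

lemma path_prob_Suc:
  assumes "1 \<le> k"
  shows "path_prob (Suc k) \<mu> P (xs(Suc k := z)) = path_prob k \<mu> P xs * P $ xs k $ z"
proof -
  have "(\<Prod>t\<in>{1..<k}. P $ (xs(Suc k := z)) t $ (xs(Suc k := z)) (t + 1))
      = (\<Prod>t\<in>{1..<k}. P $ xs t $ xs (t + 1))"
    by (intro prod.cong) auto
  then show ?thesis
    using assms by (simp add: path_prob_def)
qed

text \<open>Extensional functions represent each finite path once, so a longer path is uniquely a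
  shorter one with a last state appended.\<close>

lemma sum_PiE_Suc:
  fixes F :: "(nat \<Rightarrow> 'x::finite) \<Rightarrow> real"
  shows "(\<Sum>xs\<in>({1..Suc k} \<rightarrow>\<^sub>E UNIV). F xs) = (\<Sum>xs\<in>({1..k} \<rightarrow>\<^sub>E UNIV). \<Sum>z\<in>UNIV. F (xs(Suc k := z)))"
proof -
  have "{1..Suc k} = insert (Suc k) {1..k}"
    by auto
  then have "(\<Sum>xs\<in>({1..Suc k} \<rightarrow>\<^sub>E UNIV). F xs)
      = (\<Sum>(z, xs)\<in>UNIV \<times> ({1..k} \<rightarrow>\<^sub>E UNIV). F (xs(Suc k := z)))"
    using inj_combinator[of "Suc k" "{1..k}" "\<lambda>_. UNIV :: 'x set"]
    by (simp add: PiE_insert_eq sum.reindex case_prod_unfold)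
  also have "\<dots> = (\<Sum>xs\<in>({1..k} \<rightarrow>\<^sub>E UNIV). \<Sum>z\<in>UNIV. F (xs(Suc k := z)))"
    by (subst sum.swap) (simp add: sum.cartesian_product)
  finally show ?thesis .
qed

text \<open>By the Markov property the counts of transitions out of \<open>x\<close> evolve like i.i.d.\ draws from
  row \<open>x\<close> of \<open>P\<close>, run at the times when \<open>x\<close> is visited.\<close>

lemma path_sum_supermartingale:
  fixes P :: "real ^ 'x::finite ^ 'x"
  assumes P: "row_stochastic P" and "1 \<le> k"
    and h: "\<And>c. (\<Sum>z\<in>UNIV. P $ x $ z * h (inc c z)) \<le> h c"
  shows "(\<Sum>xs\<in>({1..k} \<rightarrow>\<^sub>E UNIV). path_prob k \<mu> P xs * h (transition_count k xs x)) \<le> h (\<lambda>_. 0)"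
  using \<open>1 \<le> k\<close>
proof (induction k rule: dec_induct)
  case base
  have "(\<Sum>xs\<in>({1..Suc 0} \<rightarrow>\<^sub>E UNIV). path_prob 1 \<mu> P xs * h (transition_count 1 xs x))
     = (\<Sum>z\<in>UNIV. pmf \<mu> z * h (\<lambda>_. 0))"
    by (subst sum_PiE_Suc) (simp add: path_prob_def transition_count_def[abs_def])
  also have "\<dots> = h (\<lambda>_. 0)"
    by (simp add: sum_pmf_eq_1 flip: sum_distrib_right)
  finally show ?case
    by simp
next
  case (step k)
  \<comment> \<open>At \<open>x\<close> this is the hypothesis on \<open>h\<close>; elsewhere the
    counts out of \<open>x\<close> stay put and the row sums to one.\<close>
  have *: "(\<Sum>z\<in>UNIV. P $ xs k $ z * h (transition_count (Suc k) (xs(Suc k := z)) x))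
      \<le> h (transition_count k xs x)" for xs
  proof (cases "xs k = x")
    case True
    then show ?thesis
      using h step.hyps by (simp add: transition_count_Suc)
  next
    case False
    then show ?thesis
      using P step.hyps by (simp add: transition_count_Suc row_stochastic_def flip: sum_distrib_right)
  qed
  have "(\<Sum>xs\<in>({1..Suc k} \<rightarrow>\<^sub>E UNIV). path_prob (Suc k) \<mu> P xs * h (transition_count (Suc k) xs x))
      = (\<Sum>xs\<in>({1..k} \<rightarrow>\<^sub>E UNIV). path_prob k \<mu> P xs *
          (\<Sum>z\<in>UNIV. P $ xs k $ z * h (transition_count (Suc k) (xs(Suc k := z)) x)))"
    using step.hyps by (subst sum_PiE_Suc) (simp add: path_prob_Suc sum_distrib_left mult_ac)
  also have "\<dots> \<le> (\<Sum>xs\<in>({1..k} \<rightarrow>\<^sub>E UNIV). path_prob k \<mu> P xs * h (transition_count k xs x))"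
    by (intro sum_mono mult_left_mono * path_prob_nonneg P)
  also have "\<dots> \<le> h (\<lambda>_. 0)"
    by (rule step.IH)
  finally show ?case .
qed

section \<open>From sums over paths to probabilities of events\<close>

text \<open>By \<open>cong\<close> the event is a finite union of the cylinders
  \<open>?E xs\<close>, whose probabilities the trajectory law prescribes; subadditivity
  suffices.\<close>

lemma markov_trajectory_event:
  fixes P :: "real ^ 'x::finite ^ 'x"
  assumes traj: "markov_trajectory M X m \<mu> P"
    and cong: "\<And>xs ys. (\<And>t. t \<in> {1..m} \<Longrightarrow> xs t = ys t) \<Longrightarrow> B xs = B ys"
  shows "{\<omega> \<in> space M. B (\<lambda>t. X t \<omega>)} \<in> sets M"
    and "measure M {\<omega> \<in> space M. B (\<lambda>t. X t \<omega>)}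
      \<le> (\<Sum>xs\<in>({1..m} \<rightarrow>\<^sub>E UNIV). path_prob m \<mu> P xs * of_bool (B xs))"
proof -
  interpret prob_space M
    using traj by (simp add: markov_trajectory_def)
  let ?E = "\<lambda>xs. {\<omega> \<in> space M. \<forall>t\<in>{1..m}. X t \<omega> = xs t}"
  let ?S = "{xs \<in> {1..m} \<rightarrow>\<^sub>E (UNIV :: 'x set). B xs}"
  have fin: "finite ({1..m} \<rightarrow>\<^sub>E (UNIV :: 'x set))"
    by (intro finite_PiE) auto
  have E: "?E xs \<in> sets M" for xs
  proof (intro sets.sets_Collect_finite_All)
    fix t assume "t \<in> {1..m}"
    then have "X t \<in> measurable M (count_space UNIV)"
      using traj by (auto simp: markov_trajectory_def)
    from measurable_sets[OF this, of "{xs t}"]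
    show "{\<omega> \<in> space M. X t \<omega> = xs t} \<in> sets M"
      by (simp add: vimage_def Int_def conj_commute)
  qed auto
  have U: "{\<omega> \<in> space M. B (\<lambda>t. X t \<omega>)} = (\<Union>xs\<in>?S. ?E xs)"
  proof (intro equalityI subsetI)
    fix \<omega> assume \<omega>: "\<omega> \<in> {\<omega> \<in> space M. B (\<lambda>t. X t \<omega>)}"
    let ?xs = "restrict (\<lambda>t. X t \<omega>) {1..m}"
    have "B ?xs"
      using \<omega> cong[of ?xs "\<lambda>t. X t \<omega>"] by simp
    then have "?xs \<in> ?S" "\<omega> \<in> ?E ?xs"
      using \<omega> by auto
    then show "\<omega> \<in> (\<Union>xs\<in>?S. ?E xs)"
      by blast
  next
    fix \<omega> assume "\<omega> \<in> (\<Union>xs\<in>?S. ?E xs)"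
    then obtain xs where "B xs" "\<omega> \<in> ?E xs"
      by blast
    then show "\<omega> \<in> {\<omega> \<in> space M. B (\<lambda>t. X t \<omega>)}"
      using cong[of xs "\<lambda>t. X t \<omega>"] by simp
  qed
  show "{\<omega> \<in> space M. B (\<lambda>t. X t \<omega>)} \<in> sets M"
    unfolding U using fin E by (intro sets.finite_UN) auto
  have "measure M {\<omega> \<in> space M. B (\<lambda>t. X t \<omega>)} \<le> (\<Sum>xs\<in>?S. measure M (?E xs))"
    unfolding U using fin E by (intro finite_measure_subadditive_finite) auto
  also have "\<dots> = (\<Sum>xs\<in>?S. path_prob m \<mu> P xs)"
    using traj by (simp add: markov_trajectory_def path_prob_def)
  also have "\<dots> = (\<Sum>xs\<in>({1..m} \<rightarrow>\<^sub>E UNIV). path_prob m \<mu> P xs * of_bool (B xs))"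
    using fin by (simp add: of_bool_def if_distrib sum.inter_filter cong: if_cong)
  finally show "measure M {\<omega> \<in> space M. B (\<lambda>t. X t \<omega>)}
      \<le> (\<Sum>xs\<in>({1..m} \<rightarrow>\<^sub>E UNIV). path_prob m \<mu> P xs * of_bool (B xs))" .
qed

lemma finite_distribution_row: "row_stochastic P \<Longrightarrow> finite_distribution (\<lambda>z. P $ x $ z)"
  by (simp add: finite_distribution_def row_stochastic_def)

section \<open>From count deviations to the estimator's error\<close>

text \<open>Over the common denominator, smoothing adds \<open>lam x * (1 - ?d * P $ x $ x')\<close>
  to the deviation. Bounding its modulus with a plus sign and summing over the row gives
  \<open>2 * (lam x * ?d)\<close>.\<close>

lemma smoothed_estimator_row_le:
  fixes P :: "real ^ 'x::finite ^ 'x"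
  assumes P: "row_stochastic P" and lam: "0 < lam x"
  shows "(\<Sum>x'\<in>UNIV. \<bar>(smoothed_estimator lam m xs - P) $ x $ x'\<bar>)
    \<le> ((\<Sum>x'\<in>UNIV. \<bar>transitions m xs x x' - visits m xs x * P $ x $ x'\<bar>) + 2 * (lam x * real CARD('x)))
      / (visits m xs x + lam x * real CARD('x))"
proof -
  let ?d = "real CARD('x)" and ?n = "visits m xs x" and ?c = "transitions m xs x"
  have n: "0 \<le> ?n"
    by (simp add: visits_def sum_nonneg)
  then have D: "0 < ?n + lam x * ?d"
    using lam by (intro add_nonneg_pos) auto
  have "(\<Sum>x'\<in>UNIV. \<bar>(smoothed_estimator lam m xs - P) $ x $ x'\<bar>)
     = (\<Sum>x'\<in>UNIV. \<bar>(?c x' - ?n * P $ x $ x') + lam x * (1 - ?d * P $ x $ x')\<bar> / (?n + lam x * ?d))"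
  proof (intro sum.cong refl)
    fix x'
    have "(smoothed_estimator lam m xs - P) $ x $ x'
       = ((?c x' - ?n * P $ x $ x') + lam x * (1 - ?d * P $ x $ x')) / (?n + lam x * ?d)"
      using D by (simp add: smoothed_estimator_def field_simps)
    then show "\<bar>(smoothed_estimator lam m xs - P) $ x $ x'\<bar>
       = \<bar>(?c x' - ?n * P $ x $ x') + lam x * (1 - ?d * P $ x $ x')\<bar> / (?n + lam x * ?d)"
      using D by simp
  qed
  also have "\<dots> \<le> (\<Sum>x'\<in>UNIV. \<bar>?c x' - ?n * P $ x $ x'\<bar> + lam x * (1 + ?d * P $ x $ x')) / (?n + lam x * ?d)"
    unfolding sum_divide_distrib[symmetric]
  proof (intro divide_right_mono sum_mono)
    fix x'
    have "\<bar>lam x * (1 - ?d * P $ x $ x')\<bar> = lam x * \<bar>1 - ?d * P $ x $ x'\<bar>"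
      using lam by (simp add: abs_mult)
    also have "\<dots> \<le> lam x * (1 + ?d * P $ x $ x')"
    proof -
      have "0 \<le> ?d * P $ x $ x'"
        using P by (simp add: row_stochastic_def)
      then show ?thesis
        using lam by (intro mult_left_mono) auto
    qed
    finally show "\<bar>(?c x' - ?n * P $ x $ x') + lam x * (1 - ?d * P $ x $ x')\<bar>
       \<le> \<bar>?c x' - ?n * P $ x $ x'\<bar> + lam x * (1 + ?d * P $ x $ x')"
      using abs_triangle_ineq[of "?c x' - ?n * P $ x $ x'" "lam x * (1 - ?d * P $ x $ x')"] by linarith
  qed (use D in simp)
  also have "(\<Sum>x'\<in>UNIV. \<bar>?c x' - ?n * P $ x $ x'\<bar> + lam x * (1 + ?d * P $ x $ x'))
      = (\<Sum>x'\<in>UNIV. \<bar>?c x' - ?n * P $ x $ x'\<bar>) + 2 * (lam x * ?d)"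
    using P by (simp add: row_stochastic_def sum.distrib flip: sum_distrib_left)
  finally show ?thesis .
qed

lemma norm_inf_le_W_hat:
  fixes P :: "real ^ 'x::finite ^ 'x"
  assumes P: "row_stochastic P" and lam: "\<And>x. 0 < lam x"
    and dev: "\<And>x. (\<Sum>x'\<in>UNIV. \<bar>transitions m xs x x' - visits m xs x * P $ x $ x'\<bar>)
      \<le> 2 * (\<Sum>x'\<in>UNIV. sqrt (transitions m xs x x'))
        + 2 * (3 / sqrt 2) * sqrt (visits m xs x) * sqrt (ln (2 * real m * real CARD('x) / \<delta>))"
  shows "norm_inf (smoothed_estimator lam m xs - P) \<le> W_hat lam \<delta> m xs"
proof -
  let ?d = "real CARD('x)"
  let ?W = "\<lambda>x. ((\<Sum>x'\<in>UNIV. sqrt (transitions m xs x x'))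
         + (3 / sqrt 2) * sqrt (visits m xs x) * sqrt (ln (2 * real m * ?d / \<delta>))
         + lam x * ?d) / (visits m xs x + lam x * ?d)"
  have "(\<Sum>x'\<in>UNIV. \<bar>(smoothed_estimator lam m xs - P) $ x $ x'\<bar>) \<le> 2 * Max (range ?W)" for x
  proof -
    have "0 \<le> visits m xs x"
      by (simp add: visits_def sum_nonneg)
    then have D: "0 < visits m xs x + lam x * ?d"
      using lam[of x] by (intro add_nonneg_pos) auto
    have "(\<Sum>x'\<in>UNIV. \<bar>(smoothed_estimator lam m xs - P) $ x $ x'\<bar>)
      \<le> ((\<Sum>x'\<in>UNIV. \<bar>transitions m xs x x' - visits m xs x * P $ x $ x'\<bar>) + 2 * (lam x * ?d))
        / (visits m xs x + lam x * ?d)"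
      by (intro smoothed_estimator_row_le P lam)
    also have "\<dots> \<le> (2 * (\<Sum>x'\<in>UNIV. sqrt (transitions m xs x x'))
        + 2 * (3 / sqrt 2) * sqrt (visits m xs x) * sqrt (ln (2 * real m * ?d / \<delta>)) + 2 * (lam x * ?d))
        / (visits m xs x + lam x * ?d)"
      using D dev[of x] by (intro divide_right_mono add_right_mono) auto
    also have "\<dots> = 2 * ?W x"
      using D by (simp add: algebra_simps add_divide_distrib)
    also have "\<dots> \<le> 2 * Max (range ?W)"
      by (intro mult_left_mono Max_ge) auto
    finally show ?thesis .
  qed
  then show ?thesis
    unfolding norm_inf_def W_hat_def by (subst Max_le_iff) auto
qed

theorem theorem3p1:
  fixes P :: "real ^ 'x::finite ^ 'x"
    and \<mu> :: "'x pmf"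
    and \<delta> :: real
    and lam :: "'x \<Rightarrow> real"
    and m :: nat
    and M :: "'w measure"
    and X :: "nat \<Rightarrow> 'w \<Rightarrow> 'x"
  assumes "ergodic P"
    and "0 < \<delta>" and "\<delta> < 1"
    and "\<And>x. 0 < lam x"
    and "1 \<le> m"
    and "markov_trajectory M X m \<mu> P"
  shows "measure M {\<omega> \<in> space M.
           norm_inf (smoothed_estimator lam m (\<lambda>t. X t \<omega>) - P) \<le> W_hat lam \<delta> m (\<lambda>t. X t \<omega>)}
         \<ge> 1 - \<delta>"
proof -
  interpret prob_space M
    using assms(6) by (simp add: markov_trajectory_def)
  have P: "row_stochastic P"
    using assms(1) by (simp add: ergodic_def)
  let ?d = "real CARD('x)"
  let ?G = "\<lambda>xs. norm_inf (smoothed_estimator lam m xs - P) \<le> W_hat lam \<delta> m xs"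
  let ?B = "\<lambda>xs. \<not> ?G xs"
  define L where "L = ln (2 * real m * ?d / \<delta>)"
  have "\<delta> < 2 * real m * ?d"
  proof -
    have "1 \<le> real m * ?d"
      using mult_mono[of 1 "real m" 1 ?d] assms(5) by (simp add: Suc_leI)
    then show ?thesis
      using assms(3) by simp
  qed
  then have L: "0 < L" "exp (- L) = \<delta> / (2 * real m * ?d)"
    using assms(2,5) by (auto simp: L_def exp_minus less_divide_eq)
  \<comment> \<open>Twice the confidence term of \<open>W_hat\<close>, as a function of the number
    of visits.\<close>
  define t where "t n = 2 * (3 / sqrt 2) * sqrt (real n) * sqrt L" for n :: nat
  define bad where "bad x n c = (of_bool (t n < finite_distribution.excess (($) (P $ x)) n c) :: real)"
    for x n c
  define h where "h x n = finite_distribution.conditional_tail (($) (P $ x)) n (bad x n)" for x n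
  have h_nonneg: "0 \<le> h x n c" for x n c
    unfolding h_def
    by (rule finite_distribution.conditional_tail_nonneg[OF finite_distribution_row[OF P]]) (simp add: bad_def)
  have h_super: "(\<Sum>z\<in>UNIV. P $ x $ z * h x n (inc c z)) \<le> h x n c" for x n c
    unfolding h_def
    by (rule finite_distribution.conditional_tail_supermartingale[OF finite_distribution_row[OF P]])
      (simp add: bad_def)
  \<comment> \<open>With no sample yet drawn, \<open>h x n\<close> is the unconditional tail
    probability of \<open>n\<close> draws.\<close>
  have h_zero: "h x n (\<lambda>_. 0) \<le> \<delta> / (2 * real m * ?d)" if "n \<in> {1..<m}" for x n
  proof -
    interpret finite_distribution "($) (P $ x)"
      by (rule finite_distribution_row[OF P])
    have n: "0 < n"
      using that by simp
    then have "0 < t n"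
      using L by (simp add: t_def)
    then have "h x n (\<lambda>_. 0) \<le> exp (- ((t n)\<^sup>2 / (8 * n)))"
      using excess_tail[OF n, of "t n"] by (simp add: h_def conditional_tail_def bad_def[abs_def])
    also have "\<dots> \<le> exp (- L)"
      using n L(1) by (simp add: t_def power_mult_distrib power_divide)
    finally show ?thesis
      by (simp only: L)
  qed
  \<comment> \<open>If the bound fails at state \<open>x\<close>, take \<open>n\<close> to be the
    realised number of visits: no draws remain, so \<open>h x n\<close> equals the indicator of the
    bad event, which is 1.\<close>
  have le: "of_bool (?B xs) \<le> (\<Sum>x\<in>UNIV. \<Sum>n\<in>{1..<m}. h x n (transition_count m xs x))" for xs
  proof (cases "?G xs")
    case True
    then show ?thesis
      by (simp add: sum_nonneg h_nonneg)
  next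
    case False
    have "\<exists>x. 2 * (\<Sum>x'\<in>UNIV. sqrt (transitions m xs x x')) + t (sum (transition_count m xs x) UNIV)
        < (\<Sum>x'\<in>UNIV. \<bar>transitions m xs x x' - visits m xs x * P $ x $ x'\<bar>)"
    proof (rule ccontr)
      assume "\<not> ?thesis"
      then have "?G xs"
        by (intro norm_inf_le_W_hat P assms(4)) (simp add: not_less t_def L_def visits_eq_count)
      with False show False ..
    qed
    then obtain x where x: "2 * (\<Sum>x'\<in>UNIV. sqrt (transitions m xs x x')) + t (sum (transition_count m xs x) UNIV)
        < (\<Sum>x'\<in>UNIV. \<bar>transitions m xs x x' - visits m xs x * P $ x $ x'\<bar>)" ..
    define c where "c = transition_count m xs x"
    define n where "n = sum c UNIV"
    interpret finite_distribution "($) (P $ x)"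
      by (rule finite_distribution_row[OF P])
    have x: "t n < excess n c"
      using x by (simp add: excess_def n_def c_def sum_subtractf transitions_eq_count visits_eq_count
        flip: sum_distrib_left)
    \<comment> \<open>An unvisited state has excess 0 and threshold 0, so the strict inequality
      excludes it.\<close>
    have "n \<noteq> 0"
    proof
      assume "n = 0"
      then have "excess n c = 0"
        by (simp add: excess_def n_def)
      with x \<open>n = 0\<close> show False
        by (simp add: t_def)
    qed
    moreover have "n < m"
      unfolding n_def c_def by (rule sum_transition_count_less[OF assms(5)])
    ultimately have n: "n \<in> {1..<m}"
      by simp
    have "of_bool (?B xs) \<le> h x n c"
      using x by (simp add: h_def conditional_tail_def bad_def n_def)
    also have "\<dots> \<le> (\<Sum>n\<in>{1..<m}. h x n c)"
      using n by (intro member_le_sum) (auto simp: h_nonneg)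
    also have "\<dots> \<le> (\<Sum>x\<in>UNIV. \<Sum>n\<in>{1..<m}. h x n (transition_count m xs x))"
      unfolding c_def by (rule member_le_sum) (auto simp: h_nonneg sum_nonneg)
    finally show ?thesis .
  qed
  have cong: "?B xs = ?B ys" if "\<And>t. t \<in> {1..m} \<Longrightarrow> xs t = ys t" for xs ys
    using transition_count_cong[OF that]
    by (simp add: smoothed_estimator_def W_hat_def transitions_eq_count visits_eq_count)
  note B = markov_trajectory_event[OF assms(6), of ?B, OF cong]
  have "measure M {\<omega> \<in> space M. ?B (\<lambda>t. X t \<omega>)}
      \<le> (\<Sum>xs\<in>({1..m} \<rightarrow>\<^sub>E UNIV). path_prob m \<mu> P xs * of_bool (?B xs))"
    by (rule B(2))
  also have "\<dots> \<le> (\<Sum>xs\<in>({1..m} \<rightarrow>\<^sub>E UNIV). path_prob m \<mu> P xs *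
      (\<Sum>x\<in>UNIV. \<Sum>n\<in>{1..<m}. h x n (transition_count m xs x)))"
    by (intro sum_mono mult_left_mono le path_prob_nonneg P)
  also have "\<dots> = (\<Sum>x\<in>UNIV. \<Sum>n\<in>{1..<m}. \<Sum>xs\<in>({1..m} \<rightarrow>\<^sub>E UNIV).
      path_prob m \<mu> P xs * h x n (transition_count m xs x))"
    unfolding sum_distrib_left
    by (subst sum.swap, intro sum.cong refl, rule sum.swap)
  \<comment> \<open>For fixed \<open>x\<close> and \<open>n\<close> the expected final value is at
    most the initial one. The \<open>?d * (m - 1)\<close> pairs together cost less than half of
    \<delta>.\<close>
  also have "\<dots> \<le> (\<Sum>x\<in>(UNIV :: 'x set). \<Sum>n\<in>{1..<m}. \<delta> / (2 * real m * ?d))"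
    by (intro sum_mono order.trans[OF path_sum_supermartingale[OF P assms(5) h_super] h_zero])
  also have "\<dots> = \<delta> * (real (m - 1) / (2 * real m))"
    by simp
  also have "\<dots> \<le> \<delta> * 1"
    using assms(2,5) by (intro mult_left_mono) (auto simp: divide_simps)
  finally have "prob {\<omega> \<in> space M. ?B (\<lambda>t. X t \<omega>)} \<le> \<delta>"
    by simp
  moreover have "{\<omega> \<in> space M. ?G (\<lambda>t. X t \<omega>)} = space M - {\<omega> \<in> space M. ?B (\<lambda>t. X t \<omega>)}"
    by auto
  ultimately show ?thesis
    using prob_compl[OF B(1)] by simp
qed

end
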